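(* Let $i,k\ge 3$ be integers and let $r=\left\lfloor\frac{F_i-1}{F_k}\right\rfloor$. Then $$N(F_i,F_{i+2},F_{i+k})=\frac{(F_i-1)(F_{i+2}-1)-rF_{k-2}\bigl(2F_i-F_k(1+r)\bigr)}{2}.$$
   Context: $F_n$ denotes the $n$-th Fibonacci number, with $F_1=F_2=1$ and $F_{n+2}=F_{n+1}+F_n$. For positive integers $a_1,\dots,a_n$ with greatest common divisor $1$, $N(a_1,\dots,a_n)$ denotes the number of positive integers that are not representable as a nonnegative integer combination of $a_1,\dots,a_n$. *)

theory Defs
  imports Complex_Main "HOL-Number_Theory.Fib"
begin

definition representable :: "nat list \<Rightarrow> nat \<Rightarrow> bool" where
  "representable as m \<longleftrightarrow>
     (\<exists>x :: nat \<Rightarrow> nat. m = (\<Sum>j<length as. x j * as ! j))"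

text \<open>
  The intended arguments are lists of positive integers with greatest common divisor 1.
  For these the set of non-representable numbers is finite, so that \<open>card\<close> is the true count.
\<close>

definition num_nonrepresentable :: "nat list \<Rightarrow> nat" where
  "num_nonrepresentable as = card {m. m > 0 \<and> \<not> representable as m}"

end

theory Submission
  imports Defs "HOL-Number_Theory.Cong"
begin

text \<open>
  Write \<open>a = fib i\<close>, \<open>b = fib (i + 2)\<close>, \<open>c = fib (i + k)\<close>, \<open>K = fib k\<close>, \<open>f = fib (k - 2)\<close>. Everything
  rests on the linear relation \<open>c = K b - f a\<close> (\<open>fib_add_relation\<close>): modulo \<open>a\<close>, one coin \<open>c\<close> does
  the work of \<open>K\<close> coins \<open>b\<close>, and it is cheaper by \<open>f a\<close>.

  As \<open>b\<close> is a unit modulo \<open>a\<close>, each residue class is that of \<open>b j\<close> for exactly one \<open>j < a\<close>. A combination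
  \<open>b y + c z\<close> equals \<open>b s - f a z\<close> with \<open>s = y + K z\<close>, so it lies in the class of \<open>b j\<close> iff
  \<open>s = j + a t\<close> for some \<open>t\<close>. For \<open>t = 0\<close> the cheapest choice trades as many \<open>b\<close> as possible for \<open>c\<close>,
  at cost \<open>w j = b (j mod K) + c (j div K)\<close>. Going around the circle (\<open>t \<ge> 1\<close>) never pays: since
  \<open>2 f \<le> K\<close> and \<open>j < a\<close>, one has \<open>2 f z \<le> K z \<le> s < 2 a t \<le> 2 b t\<close>, so the total
  saving \<open>f a z\<close> is at most the extra cost \<open>a b t\<close>. Hence \<open>w j\<close> is the least representable element of its class
  (\<open>representable_iff_ge_apery\<close>), and the class contributes \<open>w j div a\<close> gaps
  (\<open>card_gaps_eq_sum_div\<close>).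

  Finally \<open>w j div a = b j div a - f (j div K)\<close>. The first term sums over \<open>j < a\<close> to \<open>(a - 1) (b - 1) / 2\<close>,
  the number of gaps of the pair \<open>a, b\<close>; the second is an elementary sum and gives the correction
  in \<open>r\<close>.
\<close>

section \<open>Counting gaps by residue classes\<close>

lemma residues_bij_betw:
  fixes w :: "nat \<Rightarrow> nat"
  assumes "a > 0" "inj_on (\<lambda>j. w j mod a) {..<a}"
  shows "bij_betw (\<lambda>j. w j mod a) {..<a} {..<a}"
proof -
  have "(\<lambda>j. w j mod a) ` {..<a} \<subseteq> {..<a}" using assms(1) by auto
  then show ?thesis using endo_inj_surj[OF _ _ assms(2)] assms(2) by (simp add: bij_betw_def)
qed

text \<open>
  This is Selmer's gap formula, with floors in place of a separate sum over residues: if \<open>w\<close> picks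
  the least element of \<open>S\<close> in each residue class, the class of \<open>w j\<close> misses exactly the numbers
  \<open>w j mod a + q a\<close> below \<open>w j\<close>, and these are \<open>w j div a\<close> in number.
\<close>
lemma card_gaps_eq_sum_div:
  fixes w :: "nat \<Rightarrow> nat"
  assumes a: "a > 0"
    and inj: "inj_on (\<lambda>j. w j mod a) {..<a}"
    and least: "\<And>j m. j < a \<Longrightarrow> m mod a = w j mod a \<Longrightarrow> m \<in> S \<longleftrightarrow> w j \<le> m"
  shows "card (- S) = (\<Sum>j<a. w j div a)"
proof -
  let ?g = "\<lambda>(j, q). q * a + w j mod a"
  let ?D = "Sigma {..<a} (\<lambda>j. {..<w j div a})"
  have lt: "q * a + w j mod a < w j \<longleftrightarrow> q < w j div a" for q j
  proof -
    have "q * a + w j mod a < w j \<longleftrightarrow> q * a + w j mod a < w j div a * a + w j mod a"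
      by (simp only: div_mult_mod_eq)
    also have "\<dots> \<longleftrightarrow> q < w j div a"
      using a by (simp only: add_less_cancel_right mult_less_cancel2 simp_thms)
    finally show ?thesis .
  qed
  have "inj_on ?g ?D"
  proof (rule inj_onI, clarsimp)
    fix j q j' q'
    assume j: "j < a" "j' < a" and eq: "q * a + w j mod a = q' * a + w j' mod a"
    have "(q * a + w j mod a) mod a = (q' * a + w j' mod a) mod a" by (simp only: eq)
    then have "w j mod a = w j' mod a" by simp
    then show "j = j' \<and> q = q'" using inj j eq a by (auto dest: inj_onD)
  qed
  moreover have "?g ` ?D = - S"
  proof (intro equalityI subsetI)
    fix m assume "m \<in> ?g ` ?D"
    then obtain j q where "j < a" "q < w j div a" "m = q * a + w j mod a" by auto
    then show "m \<in> - S" using least[of j m] lt[of q j] by auto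
  next
    fix m assume m: "m \<in> - S"
    have "m mod a \<in> (\<lambda>j. w j mod a) ` {..<a}"
      using residues_bij_betw[OF a inj] a by (auto simp: bij_betw_def)
    then obtain j where j: "j < a" "m mod a = w j mod a" by auto
    then have "m = ?g (j, m div a)" by (simp flip: j(2))
    moreover have "m < w j" using least[OF j] m by auto
    ultimately have "(j, m div a) \<in> ?D" using lt[of "m div a" j] j by simp
    with \<open>m = ?g (j, m div a)\<close> show "m \<in> ?g ` ?D" by (rule image_eqI)
  qed
  ultimately have "card (- S) = card ?D" by (metis card_image)
  then show ?thesis by simp
qed

section \<open>Two floor sums\<close>

text \<open>
  Multiplication by \<open>b\<close> permutes the residues modulo \<open>a\<close>, so the remainders of the numbers \<open>b j\<close> add up
  to \<open>0 + 1 + \<dots> + (a - 1)\<close>.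
\<close>
lemma sum_mult_div_if_inj_mod:
  fixes a b :: nat
  assumes "a > 0" and inj: "inj_on (\<lambda>j. (b * j) mod a) {..<a}"
  shows "2 * int (\<Sum>j<a. (b * j) div a) = (int a - 1) * (int b - 1)"
proof -
  have "(\<Sum>j<a. b * j) = (\<Sum>j<a. a * ((b * j) div a)) + (\<Sum>j<a. (b * j) mod a)"
    by (simp flip: sum.distrib)
  also have "(\<Sum>j<a. (b * j) mod a) = (\<Sum>j<a. j)"
    using sum.reindex_bij_betw[OF residues_bij_betw[OF assms], of "\<lambda>x. x"] by simp
  finally have "b * (\<Sum>j<a. j) = a * (\<Sum>j<a. (b * j) div a) + (\<Sum>j<a. j)"
    by (simp only: sum_distrib_left)
  then have "int b * int (\<Sum>j<a. j) = int a * int (\<Sum>j<a. (b * j) div a) + int (\<Sum>j<a. j)"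
    by (metis of_nat_add of_nat_mult)
  moreover have gauss: "2 * int (\<Sum>j<n. j) = int n * (int n - 1)" for n
    by (induction n) (auto simp: algebra_simps)
  note gauss[of a]
  ultimately have "int a * (2 * int (\<Sum>j<a. (b * j) div a)) = int a * ((int a - 1) * (int b - 1))"
    by algebra
  then show ?thesis using assms(1) by simp
qed

lemma sum_div:
  fixes K n :: nat
  shows "2 * int (\<Sum>j\<le>n. j div K)
    = int (n div K) * (2 * (int n + 1) - int K * (1 + int (n div K)))"
proof (induction n)
  case 0
  then show ?case by simp
next
  case (Suc n)
  show ?case
  proof (cases "Suc n mod K = 0")
    case True
    then have d: "Suc n div K = Suc (n div K)" by (simp add: div_Suc)
    then have "Suc n = Suc (n div K) * K" using True by (metis add.right_neutral div_mult_mod_eq)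
    then have "int n = (int (n div K) + 1) * int K - 1"
      by (metis add_diff_cancel_right' of_nat_Suc of_nat_mult add.commute)
    then show ?thesis using Suc d by (simp add: algebra_simps)
  next
    case False
    then have "Suc n div K = n div K" by (simp add: div_Suc)
    then show ?thesis using Suc by (simp add: algebra_simps)
  qed
qed

section \<open>Triples in which the third generator replaces copies of the second\<close>

lemma representable_triple_iff:
  "representable [a, b, c] m \<longleftrightarrow> (\<exists>x y z. m = x * a + y * b + z * c)"
proof
  assume "\<exists>x y z. m = x * a + y * b + z * c"
  then obtain x y z where "m = x * a + y * b + z * c" by blast
  then show "representable [a, b, c] m" unfolding representable_def
    by (intro exI[of _ "\<lambda>j. [x, y, z] ! j"]) (simp add: numeral_3_eq_3)
qed (auto simp: representable_def numeral_3_eq_3)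

locale replacement_triple =
  fixes a b c K f :: nat
  assumes a_pos: "a > 0" and K_pos: "K > 0"
    and coprime: "coprime a b" and a_le_b: "a \<le> b" and f_le: "2 * f \<le> K"
    and relation: "c + f * a = K * b"
begin

text \<open>
  The Apery set of the triple with respect to \<open>a\<close>, indexed so that \<open>apery j\<close> lies in the residue class
  of \<open>b j\<close> rather than in that of \<open>j\<close>.
\<close>
definition apery :: "nat \<Rightarrow> nat" where
  "apery j = b * (j mod K) + c * (j div K)"

lemma apery_plus: "apery j + a * (f * (j div K)) = b * j"
proof -
  have "apery j + a * (f * (j div K)) = b * (j mod K) + (c + f * a) * (j div K)"
    by (simp add: apery_def algebra_simps)
  also have "\<dots> = b * (j mod K + K * (j div K))"
    unfolding relation by (simp only: distrib_left mult_ac)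
  finally show ?thesis by simp
qed

lemma apery_mod: "apery j mod a = (b * j) mod a"
  by (simp flip: apery_plus[of j])

lemma apery_div: "(b * j) div a = apery j div a + f * (j div K)"
  using a_pos by (simp flip: apery_plus[of j])

lemma inj_residues: "inj_on (\<lambda>j. (b * j) mod a) {..<a}"
proof (rule inj_onI)
  fix x y assume xy: "x \<in> {..<a}" "y \<in> {..<a}" "(b * x) mod a = (b * y) mod a"
  then have "[x = y] (mod a)" using coprime
    by (metis cong_def cong_mult_lcancel_nat coprime_commute)
  then show "x = y" using xy by (simp add: cong_def)
qed

text \<open>
  Apart from copies of \<open>a\<close>, a combination in the class of \<open>b j\<close> is worth as much as
  \<open>y + K z = j + a t\<close> copies of \<open>b\<close>, less a discount of \<open>f a\<close> for each of the \<open>z\<close> copies of \<open>c\<close>. If \<open>t = 0\<close>, at most \<open>j div K\<close> discounts are possible;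
  if \<open>t \<ge> 1\<close>, all discounts together do not exceed the price of the \<open>a t\<close> superfluous copies of \<open>b\<close>.
\<close>
lemma representable_iff_ge_apery:
  assumes j: "j < a" and m: "m mod a = apery j mod a"
  shows "representable [a, b, c] m \<longleftrightarrow> apery j \<le> m"
proof
  assume le: "apery j \<le> m"
  then have "a dvd m - apery j" using m by (metis mod_eq_dvd_iff_nat)
  then obtain x where "m - apery j = a * x" by blast
  then have "m = x * a + (j mod K) * b + (j div K) * c"
    using le by (simp add: apery_def algebra_simps)
  then show "representable [a, b, c] m" unfolding representable_triple_iff by blast
next
  assume "representable [a, b, c] m"
  then obtain x y z where xyz: "m = x * a + y * b + z * c"
    unfolding representable_triple_iff by blast
  define s where "s = y + K * z"
  have "m + a * (f * z) = x * a + y * b + z * (c + f * a)" by (simp add: xyz algebra_simps)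
  also have "\<dots> = a * x + b * s" by (simp only: relation s_def) (simp add: algebra_simps)
  finally have ms: "m + a * (f * z) = a * x + b * s" .
  have "(b * s) mod a = (a * x + b * s) mod a" by simp
  also have "\<dots> = m mod a" by (simp flip: ms)
  finally have "[b * s = b * j] (mod a)" using m apery_mod by (simp add: cong_def)
  then have "[s = j] (mod a)" using coprime
    by (metis cong_mult_lcancel_nat coprime_commute)
  then have "s mod a = j" using j by (simp add: cong_def)
  then have st: "s = j + a * (s div a)" by (metis mod_mult_div_eq)
  show "apery j \<le> m"
  proof (cases "s div a = 0")
    case True
    then have "K * z \<le> j" using st s_def by simp
    then have "z \<le> j div K" using K_pos by (simp add: less_eq_div_iff_mult_less_eq mult.commute)
    then have "a * (f * z) \<le> a * (f * (j div K))" by simp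
    moreover have "m + a * (f * z) = a * x + b * j" using ms st True by simp
    ultimately show ?thesis using apery_plus[of j] by linarith
  next
    case False
    define t where "t = s div a"
    have "a \<le> a * t" using False by (simp add: t_def)
    have "2 * f * z \<le> K * z" using f_le by (rule mult_le_mono1)
    also have "\<dots> \<le> j + a * t" using st s_def t_def by simp
    also have "\<dots> \<le> 2 * (a * t)" using j \<open>a \<le> a * t\<close> by linarith
    also have "\<dots> \<le> 2 * (b * t)" using a_le_b by simp
    finally have "a * (f * z) \<le> a * (b * t)" by simp
    moreover have "b * s = b * j + a * (b * t)" using st t_def by (metis distrib_left mult.left_commute)
    ultimately show ?thesis using ms apery_plus[of j] by linarith
  qed
qed

theorem num_nonrepresentable_triple:
  "2 * int (num_nonrepresentable [a, b, c]) = (int a - 1) * (int b - 1)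
    - int f * (int ((a - 1) div K) * (2 * int a - int K * (1 + int ((a - 1) div K))))"
proof -
  have "representable [a, b, c] 0" by (auto simp: representable_triple_iff)
  then have "{m. m > 0 \<and> \<not> representable [a, b, c] m} = - {m. representable [a, b, c] m}"
    by (auto intro: gr0I)
  moreover have "card (- {m. representable [a, b, c] m}) = (\<Sum>j<a. apery j div a)"
    using a_pos inj_residues representable_iff_ge_apery
    by (intro card_gaps_eq_sum_div) (simp_all add: apery_mod)
  ultimately have "num_nonrepresentable [a, b, c] = (\<Sum>j<a. apery j div a)"
    by (simp only: num_nonrepresentable_def)
  then have "(\<Sum>j<a. (b * j) div a) = num_nonrepresentable [a, b, c] + f * (\<Sum>j<a. j div K)"
    by (simp add: apery_div sum.distrib sum_distrib_left)
  then have "2 * int (num_nonrepresentable [a, b, c])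
      = 2 * int (\<Sum>j<a. (b * j) div a) - int f * (2 * int (\<Sum>j<a. j div K))"
    by simp
  also have "2 * int (\<Sum>j<a. (b * j) div a) = (int a - 1) * (int b - 1)"
    using a_pos inj_residues by (rule sum_mult_div_if_inj_mod)
  also have "2 * int (\<Sum>j<a. j div K)
      = int ((a - 1) div K) * (2 * int a - int K * (1 + int ((a - 1) div K)))"
  proof -
    have "{..<a} = {..a - 1}" "int (a - 1) + 1 = int a" using a_pos by auto
    then show ?thesis using sum_div[where n = "a - 1" and K = K] by (simp only:)
  qed
  finally show ?thesis .
qed

end

section \<open>The Fibonacci triple\<close>

lemma fib_add_relation: "fib (i + n + 2) + fib n * fib i = fib (n + 2) * fib (i + 2)"
  by (induction n rule: fib.induct) (auto simp: algebra_simps)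

lemma replacement_triple_fib:
  assumes "i > 0" "k \<ge> 2"
  shows "replacement_triple (fib i) (fib (i + 2)) (fib (i + k)) (fib k) (fib (k - 2))"
proof
  obtain n where k: "k = n + 2" using assms(2) by (metis add.commute le_Suc_ex)
  show "fib i > 0" "fib k > 0" using assms by (simp_all add: fib_neq_0_nat)
  show "coprime (fib i) (fib (i + 2))"
    using coprime_fib_Suc_nat[of i] by (simp add: coprime_iff_gcd_eq_1 add.commute[of "fib (Suc i)"])
  show "fib i \<le> fib (i + 2)" by (simp add: fib_mono)
  show "2 * fib (k - 2) \<le> fib k" using fib_mono[of n "Suc n"] by (simp add: k)
  show "fib (i + k) + fib (k - 2) * fib i = fib k * fib (i + 2)"
    using fib_add_relation[of i n] by (simp add: k add.assoc)
qed

theorem corollary1p2: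
  fixes i k :: nat and r :: int
  assumes "i \<ge> 3" and "k \<ge> 3"
    and "r = \<lfloor>(real (fib i) - 1) / real (fib k)\<rfloor>"
  shows "real (num_nonrepresentable [fib i, fib (i + 2), fib (i + k)]) =
    ((real (fib i) - 1) * (real (fib (i + 2)) - 1)
      - of_int r * real (fib (k - 2)) * (2 * real (fib i) - real (fib k) * (1 + of_int r))) / 2"
proof -
  interpret replacement_triple "fib i" "fib (i + 2)" "fib (i + k)" "fib k" "fib (k - 2)"
    using assms by (intro replacement_triple_fib) auto
  have "real (fib i) - 1 = real (fib i - 1)" using a_pos by (simp add: of_nat_diff)
  then have r: "r = int ((fib i - 1) div fib k)"
    using assms(3) by (simp only: floor_divide_of_nat_eq)
  have "real_of_int (2 * int (num_nonrepresentable [fib i, fib (i + 2), fib (i + k)]))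
    = real_of_int ((int (fib i) - 1) * (int (fib (i + 2)) - 1)
      - int (fib (k - 2)) * (r * (2 * int (fib i) - int (fib k) * (1 + r))))"
    by (simp only: num_nonrepresentable_triple r)
  then show ?thesis by (simp del: fib.simps add: algebra_simps)
qed

end
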